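(* Let $\mathcal{P}=(V,P)$ be a finite poset with $\dim(\mathcal{P})>1$, and let $G_\mathcal{P}$ be its underlying comparability graph. Then $\dim(\mathcal{P})\le 2\,\mathrm{box}(G_\mathcal{P})$.
   Context: A $k$-box is a Cartesian product of $k$ closed real intervals. The boxicity $\mathrm{box}(G)$ of a finite simple graph $G$ is the minimum integer $k$ such that vertices of $G$ can be mapped to $k$-boxes with two vertices adjacent iff their boxes intersect; the boxicity of a complete graph is $0$. Equivalently, for a non-complete graph it is the minimum number of interval graphs on $V(G)$ whose edge sets intersect to $E(G)$. A realizer of a poset $(S,P)$ is a set $\mathcal{R}$ of linear extensions of $P$ such that for distinct $x,y$, $x<y$ in $P$ iff $x<y$ in every $L\in\mathcal{R}$; the dimension $\dim(\mathcal{P})$ is the minimum size of a realizer. The underlying comparability graph $G_\mathcal{P}$ has vertex set $S$, with two distinct vertices adjacent iff they are comparable in $P$. *)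

theory Defs
  imports Complex_Main "HOL-Library.FuncSet" "Graph_Theory.Pair_Digraph"
begin

definition closed_interval :: "real set \<Rightarrow> bool" where
  "closed_interval I \<longleftrightarrow> (\<exists>l u. l \<le> u \<and> I = {l..u})"

definition is_box :: "nat \<Rightarrow> (nat \<Rightarrow> real) set \<Rightarrow> bool" where
  "is_box k B \<longleftrightarrow> (\<exists>I. (\<forall>i<k. closed_interval (I i)) \<and> B = (\<Pi>\<^sub>E i\<in>{..<k}. I i))"

definition box_representation ::
    "'a pair_pre_digraph \<Rightarrow> nat \<Rightarrow> ('a \<Rightarrow> (nat \<Rightarrow> real) set) \<Rightarrow> bool" where
  "box_representation G k f \<longleftrightarrow>
     (\<forall>v\<in>pverts G. is_box k (f v)) \<and>
     (\<forall>u\<in>pverts G. \<forall>v\<in>pverts G. u \<noteq> v \<longrightarrow> ((u, v) \<in> parcs G \<longleftrightarrow> f u \<inter> f v \<noteq> {}))"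

text \<open>The only 0-box is a single point, so the graphs with a representation for \<open>k = 0\<close> are
  exactly the complete ones. Every finite simple graph has a representation for some \<open>k\<close>.\<close>

definition boxicity :: "'a pair_pre_digraph \<Rightarrow> nat" where
  "boxicity G = (LEAST k. \<exists>f. box_representation G k f)"

definition linear_extension_on :: "'a set \<Rightarrow> 'a rel \<Rightarrow> 'a rel \<Rightarrow> bool" where
  "linear_extension_on V P L \<longleftrightarrow> linear_order_on V L \<and> P \<subseteq> L"

definition realizer_on :: "'a set \<Rightarrow> 'a rel \<Rightarrow> 'a rel set \<Rightarrow> bool" where
  "realizer_on V P R \<longleftrightarrow>
     (\<forall>L\<in>R. linear_extension_on V P L) \<and>
     (\<forall>x\<in>V. \<forall>y\<in>V. x \<noteq> y \<longrightarrow> ((x, y) \<in> P \<longleftrightarrow> (\<forall>L\<in>R. (x, y) \<in> L)))"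

text \<open>Posets with at most one element have the empty realizer, hence dimension 0 here.\<close>

definition poset_dim :: "'a set \<Rightarrow> 'a rel \<Rightarrow> nat" where
  "poset_dim V P = (LEAST k. \<exists>R. realizer_on V P R \<and> finite R \<and> card R = k)"

text \<open>Undirected edges are represented by both arcs.\<close>

definition comparability_graph :: "'a set \<Rightarrow> 'a rel \<Rightarrow> 'a pair_pre_digraph" where
  "comparability_graph V P =
     \<lparr> pverts = V,
       parcs = {(x, y). x \<in> V \<and> y \<in> V \<and> x \<noteq> y \<and> ((x, y) \<in> P \<or> (y, x) \<in> P)} \<rparr>"

lemma pair_graph_comparability_graph:
  assumes "finite V"
  shows "pair_graph (comparability_graph V P)"
proof -
  have "parcs (comparability_graph V P) \<subseteq> V \<times> V"
    by (auto simp: comparability_graph_def)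
  then have "finite (parcs (comparability_graph V P))"
    using assms by (meson finite_SigmaI finite_subset)
  then show ?thesis
    using assms
    by unfold_locales
       (auto simp: comparability_graph_def symmetric_def arcs_ends_def arc_to_ends_def sym_def)
qed

end

theory Submission
  imports Defs
begin

text \<open>Fix one coordinate of a box representation of the comparability graph, giving intervals
  \<open>[l v, u v]\<close>. Comparable elements have intersecting intervals, so \<open>\<phi> x = max {l a. a \<le> x}\<close>
  is monotone, and \<open>u x < l y\<close> implies \<open>\<phi> x \<le> u x < l y \<le> \<phi> y\<close>. Sorting by \<open>\<phi>\<close> and breaking ties
  suitably yields a linear extension that respects the left-to-right order of disjoint intervals.
  Reflecting the line yields a second one that reverses this order. As incomparable elements are
  separated in some coordinate, these pairs of extensions form a realizer.\<close>

text \<open>Ties of \<phi> are broken by the size \<open>n\<close> of the principal down-set, which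
  grows strictly along \<open>P\<close>, and then by an arbitrary injection \<open>g\<close> into
  the naturals, which makes the lexicographic order total.\<close>

lemma linear_extension_by_monotone_key:
  fixes \<phi> :: "'a \<Rightarrow> 'b::linorder"
  assumes fin: "finite V" and po: "partial_order_on V P"
    and mono: "\<And>x y. (x, y) \<in> P \<Longrightarrow> \<phi> x \<le> \<phi> y"
  obtains L where "linear_extension_on V P L"
    and "\<And>x y. x \<in> V \<Longrightarrow> y \<in> V \<Longrightarrow> \<phi> x < \<phi> y \<Longrightarrow> (x, y) \<in> L"
proof -
  have sub: "P \<subseteq> V \<times> V" and refl: "\<And>x. x \<in> V \<Longrightarrow> (x, x) \<in> P"
    and tr: "\<And>x y z. (x, y) \<in> P \<Longrightarrow> (y, z) \<in> P \<Longrightarrow> (x, z) \<in> P"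
    and anti: "\<And>x y. (x, y) \<in> P \<Longrightarrow> (y, x) \<in> P \<Longrightarrow> x = y"
    using po by (auto simp: partial_order_on_def preorder_on_def refl_on_def trans_def antisym_def)
  obtain g :: "'a \<Rightarrow> nat" where g: "inj_on g V"
    using finite_imp_inj_to_nat_seg[OF fin] by blast
  define n where "n x = card {a. (a, x) \<in> P}" for x
  have n: "n x < n y" if "(x, y) \<in> P" "x \<noteq> y" for x y
    unfolding n_def
  proof (rule psubset_card_mono)
    show "finite {a. (a, y) \<in> P}"
      by (rule finite_subset[OF _ fin]) (use sub in auto)
    \<comment> \<open>The inclusion is strict because y lies in its own down-set but, by
      antisymmetry, not in that of x.\<close>
    show "{a. (a, x) \<in> P} \<subset> {a. (a, y) \<in> P}"
      using that sub refl tr anti by blast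
  qed
  define L where "L = {(x, y) \<in> V \<times> V.
    \<phi> x < \<phi> y \<or> \<phi> x = \<phi> y \<and> (n x < n y \<or> n x = n y \<and> g x \<le> g y)}"
  have "linear_order_on V L"
    using g unfolding linear_order_on_def partial_order_on_def preorder_on_def
    by (auto simp: L_def refl_on_def trans_def antisym_def total_on_def inj_on_def)
  moreover have "P \<subseteq> L"
  proof
    fix p assume p: "p \<in> P"
    obtain x y where [simp]: "p = (x, y)" by fastforce
    have "\<phi> x \<le> \<phi> y" "x \<in> V" "y \<in> V" "x = y \<or> n x < n y"
      using p mono n sub by auto
    then show "p \<in> L"
      by (auto simp: L_def)
  qed
  ultimately show thesis
    by (intro that[of L]) (auto simp: linear_extension_on_def L_def)
qed

text \<open>\<open>meet\<close> is one half of the condition that two intervals intersect. Replacing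
  \<open>l\<close>, \<open>u\<close> by \<open>-u\<close>, \<open>-l\<close> turns it into the other
  half, so the lemma also serves the reflected line.\<close>

lemma linear_extension_respecting_intervals:
  fixes l u :: "'a \<Rightarrow> 'b::linorder"
  assumes fin: "finite V" and po: "partial_order_on V P"
    and meet: "\<And>x y. (x, y) \<in> P \<Longrightarrow> l x \<le> u y"
  obtains L where "linear_extension_on V P L"
    and "\<And>x y. x \<in> V \<Longrightarrow> y \<in> V \<Longrightarrow> u x < l y \<Longrightarrow> (x, y) \<in> L"
proof -
  define D where "D x = {a. (a, x) \<in> P}" for x
  define \<phi> where "\<phi> x = Max (l ` D x)" for x
  have sub: "P \<subseteq> V \<times> V" and refl: "\<And>x. x \<in> V \<Longrightarrow> (x, x) \<in> P" and tr: "trans P"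
    using po by (auto simp: partial_order_on_def preorder_on_def refl_on_def)
  have finD: "finite (D x)" for x
    by (rule finite_subset[OF _ fin]) (use sub in \<open>auto simp: D_def\<close>)
  have self: "x \<in> D x" if "x \<in> V" for x
    using refl that by (simp add: D_def)
  have mono: "\<phi> x \<le> \<phi> y" if "(x, y) \<in> P" for x y
    unfolding \<phi>_def
  proof (rule Max_mono)
    show "l ` D x \<subseteq> l ` D y"
      using that tr by (auto simp: D_def dest: transD)
    show "l ` D x \<noteq> {}"
      using that sub self by blast
  qed (use finD in simp)
  have key: "\<phi> x < \<phi> y" if "x \<in> V" "y \<in> V" "u x < l y" for x y
  proof -
    \<comment> \<open>\<open>meet\<close> bounds \<open>l a\<close> by \<open>u x\<close> for every
      a below x, hence also the maximum.\<close>
    have "\<phi> x \<le> u x"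
      unfolding \<phi>_def using finD self[OF that(1)] meet by (subst Max_le_iff) (auto simp: D_def)
    also note \<open>u x < l y\<close>
    also have "l y \<le> \<phi> y"
      unfolding \<phi>_def using finD self[OF that(2)] by (intro Max_ge) auto
    finally show ?thesis .
  qed
  obtain L where "linear_extension_on V P L"
    and "\<And>x y. x \<in> V \<Longrightarrow> y \<in> V \<Longrightarrow> \<phi> x < \<phi> y \<Longrightarrow> (x, y) \<in> L"
    using linear_extension_by_monotone_key[of V P \<phi>] fin po mono by metis
  with key that show thesis by blast
qed

text \<open>Boxes meet iff they meet in every coordinate, and nonempty intervals meet iff neither
  ends before the other begins. For \<open>k = 0\<close> both sides call all distinct vertices
  adjacent, since the empty product is a single point.\<close>

lemma box_representation_iff_intervals:
  "(\<exists>f. box_representation G k f) \<longleftrightarrow>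
   (\<exists>l u :: 'a \<Rightarrow> nat \<Rightarrow> real.
      (\<forall>v\<in>pverts G. \<forall>i<k. l v i \<le> u v i) \<and>
      (\<forall>v\<in>pverts G. \<forall>w\<in>pverts G. v \<noteq> w \<longrightarrow>
         ((v, w) \<in> parcs G \<longleftrightarrow> (\<forall>i<k. l v i \<le> u w i \<and> l w i \<le> u v i))))"
  (is "?L = ?R")
proof -
  have inter: "(\<Pi>\<^sub>E i\<in>{..<k}. {l v i..u v i}) \<inter> (\<Pi>\<^sub>E i\<in>{..<k}. {l w i..u w i}) \<noteq> {} \<longleftrightarrow>
      (\<forall>i<k. l v i \<le> u w i \<and> l w i \<le> u v i)"
    if "\<forall>i<k. l v i \<le> u v i" "\<forall>i<k. l w i \<le> u w i" for l u :: "'a \<Rightarrow> nat \<Rightarrow> real" and v w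
    using that by (auto simp: PiE_Int PiE_eq_empty_iff)
  show ?thesis
  proof
    assume ?L
    then obtain f where f: "box_representation G k f" ..
    have "\<forall>v\<in>pverts G. \<exists>l u. (\<forall>i<k. l i \<le> u i) \<and> f v = (\<Pi>\<^sub>E i\<in>{..<k}. {l i..u i})"
    proof
      fix v assume "v \<in> pverts G"
      with f obtain I where I: "\<forall>i<k. closed_interval (I i)" "f v = (\<Pi>\<^sub>E i\<in>{..<k}. I i)"
        unfolding box_representation_def is_box_def by blast
      from I(1) obtain l u where lu: "\<forall>i<k. l i \<le> u i \<and> I i = {l i..u i}"
        unfolding closed_interval_def by metis
      then have "f v = (\<Pi>\<^sub>E i\<in>{..<k}. {l i..u i})"
        unfolding I(2) by (intro PiE_cong) auto
      with lu show "\<exists>l u. (\<forall>i<k. l i \<le> u i) \<and> f v = (\<Pi>\<^sub>E i\<in>{..<k}. {l i..u i})"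
        by blast
    qed
    then obtain l u where lu: "\<forall>v\<in>pverts G. \<forall>i<k. l v i \<le> u v i"
        "\<forall>v\<in>pverts G. f v = (\<Pi>\<^sub>E i\<in>{..<k}. {l v i..u v i})"
      by metis
    have "\<forall>v\<in>pverts G. \<forall>w\<in>pverts G. v \<noteq> w \<longrightarrow>
        ((v, w) \<in> parcs G \<longleftrightarrow> (\<forall>i<k. l v i \<le> u w i \<and> l w i \<le> u v i))"
      using f lu inter unfolding box_representation_def by simp
    with lu(1) show ?R by blast
  next
    assume ?R
    then obtain l u :: "'a \<Rightarrow> nat \<Rightarrow> real" where lu: "\<forall>v\<in>pverts G. \<forall>i<k. l v i \<le> u v i"
      "\<forall>v\<in>pverts G. \<forall>w\<in>pverts G. v \<noteq> w \<longrightarrow>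
        ((v, w) \<in> parcs G \<longleftrightarrow> (\<forall>i<k. l v i \<le> u w i \<and> l w i \<le> u v i))"
      by blast
    have "box_representation G k (\<lambda>v. \<Pi>\<^sub>E i\<in>{..<k}. {l v i..u v i})"
      unfolding box_representation_def is_box_def closed_interval_def
      using lu inter by (intro conjI ballI impI exI) auto
    then show ?L by blast
  qed
qed

text \<open>This guarantees that the \<open>LEAST\<close> in \<open>boxicity\<close> is
  attained.\<close>

lemma (in pair_graph) box_representation_exists:
  "\<exists>k f. box_representation G k f"
proof -
  obtain h :: "nat \<Rightarrow> 'a" where h: "bij_betw h {0..<card (pverts G)} (pverts G)"
    using ex_bij_betw_nat_finite[OF pair_finite_verts] by blast
  let ?k = "card (pverts G)"
  \<comment> \<open>Coordinate \<open>i\<close> separates \<open>h i\<close> from its non-neighbours and nothing else.\<close>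
  define l u :: "'a \<Rightarrow> nat \<Rightarrow> real"
    where "l v i = (if v = h i \<or> (v, h i) \<in> parcs G then 0 else 1)"
      and "u v i = (if v = h i then 0 else 1)" for v i
  have sym: "(v, w) \<in> parcs G \<longleftrightarrow> (w, v) \<in> parcs G" for v w
    using arcs_symmetric by blast
  have ex: "\<exists>i<?k. v = h i" if "v \<in> pverts G" for v
    using that bij_betw_imp_surj_on[OF h] by (metis atLeastLessThan_iff imageE)
  have adj: "(v, w) \<in> parcs G \<longleftrightarrow> (\<forall>i<?k. l v i \<le> u w i \<and> l w i \<le> u v i)"
    if vw: "v \<in> pverts G" "w \<in> pverts G" "v \<noteq> w" for v w
  proof
    assume "(v, w) \<in> parcs G"
    \<comment> \<open>\<open>l\<close> inspects only arcs into \<open>h i\<close>, and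
      \<open>h i\<close> may be either endpoint.\<close>
    then have "(w, v) \<in> parcs G"
      using sym by blast
    with \<open>(v, w) \<in> parcs G\<close> show "\<forall>i<?k. l v i \<le> u w i \<and> l w i \<le> u v i"
      by (auto simp: l_def u_def)
  next
    assume *: "\<forall>i<?k. l v i \<le> u w i \<and> l w i \<le> u v i"
    \<comment> \<open>In the coordinate of w, the interval of w is the point 0, so v must start at 0
      and is a neighbour of w.\<close>
    obtain i where "i < ?k" "w = h i"
      using ex[OF vw(2)] by blast
    with * have "l v i \<le> u w i"
      by blast
    with \<open>w = h i\<close> vw(3) show "(v, w) \<in> parcs G"
      by (simp add: l_def u_def split: if_splits)
  qed
  have "l v i \<le> u v i" for v i
    by (simp add: l_def u_def)
  with adj have "\<exists>f. box_representation G ?k f"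
    unfolding box_representation_iff_intervals by (intro exI[of _ l] exI[of _ u]) blast
  then show ?thesis ..
qed

lemma linear_order_on_antisym:
  assumes "linear_order_on V L" "(x, y) \<in> L" "(y, x) \<in> L"
  shows "x = y"
  using assms by (auto simp: linear_order_on_def partial_order_on_def antisym_def)

text \<open>Only incomparable pairs need a separating extension: if y is below x in
  \<open>P\<close>, every member of \<open>R\<close> already puts y first, and \<open>R\<close> has
  a member. As \<open>sep\<close> covers ordered pairs, incomparable elements occur in both
  orders.\<close>

lemma realizer_onI:
  assumes ext: "\<And>L. L \<in> R \<Longrightarrow> linear_extension_on V P L" and "R \<noteq> {}"
    and sep: "\<And>x y. x \<in> V \<Longrightarrow> y \<in> V \<Longrightarrow> x \<noteq> y \<Longrightarrow> (x, y) \<notin> P \<Longrightarrow> (y, x) \<notin> P \<Longrightarrow>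
      \<exists>L\<in>R. (y, x) \<in> L"
  shows "realizer_on V P R"
proof -
  have "(x, y) \<in> P" if "x \<in> V" "y \<in> V" "x \<noteq> y" and all: "\<forall>L\<in>R. (x, y) \<in> L" for x y
  proof (rule ccontr)
    assume "(x, y) \<notin> P"
    with that sep \<open>R \<noteq> {}\<close> ext obtain L where L: "L \<in> R" "(y, x) \<in> L"
      unfolding linear_extension_on_def by blast
    then show False
      using ext[of L] all linear_order_on_antisym[of V L x y] \<open>x \<noteq> y\<close>
      by (auto simp: linear_extension_on_def)
  qed
  then show ?thesis
    using ext unfolding realizer_on_def linear_extension_on_def by blast
qed

lemma poset_dim_le:
  assumes "realizer_on V P R" "finite R"
  shows "poset_dim V P \<le> card R"
  unfolding poset_dim_def using assms by (intro Least_le) blast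

theorem theorem1:
  fixes V :: "'a set" and P :: "'a rel"
  assumes "finite V"
    and "partial_order_on V P"
    and "poset_dim V P > 1"
  shows "poset_dim V P \<le> 2 * boxicity (comparability_graph V P)"
proof -
  let ?G = "comparability_graph V P"
  let ?k = "boxicity ?G"
  note fin = assms(1) and po = assms(2)
  have sub: "P \<subseteq> V \<times> V"
    using po by (auto simp: partial_order_on_def preorder_on_def)
  have "\<exists>f. box_representation ?G ?k f"
    unfolding boxicity_def
    using pair_graph.box_representation_exists[OF pair_graph_comparability_graph[OF fin]]
    by (rule LeastI_ex)
  then obtain l u :: "'a \<Rightarrow> nat \<Rightarrow> real" where lu:
    "\<forall>v\<in>pverts ?G. \<forall>i<?k. l v i \<le> u v i"
    "\<forall>v\<in>pverts ?G. \<forall>w\<in>pverts ?G. v \<noteq> w \<longrightarrow>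
      ((v, w) \<in> parcs ?G \<longleftrightarrow> (\<forall>i<?k. l v i \<le> u w i \<and> l w i \<le> u v i))"
    unfolding box_representation_iff_intervals by blast
  have [simp]: "pverts ?G = V"
    by (simp add: comparability_graph_def)
  have le: "l v i \<le> u v i" if "v \<in> V" "i < ?k" for v i
    using lu(1) that by simp
  have adj: "((v, w) \<in> P \<or> (w, v) \<in> P) \<longleftrightarrow> (\<forall>i<?k. l v i \<le> u w i \<and> l w i \<le> u v i)"
    if "v \<in> V" "w \<in> V" "v \<noteq> w" for v w
  proof -
    have "(v, w) \<in> parcs ?G \<longleftrightarrow> (v, w) \<in> P \<or> (w, v) \<in> P"
      using that by (simp add: comparability_graph_def)
    with lu(2) that show ?thesis by simp
  qed
  \<comment> \<open>Reflexive pairs are not edges; for them the claim is that intervals are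
    nonempty.\<close>
  have meet: "l x i \<le> u y i \<and> l y i \<le> u x i" if "(x, y) \<in> P" "i < ?k" for x y i
    using that sub le adj[of x y] by (cases "x = y") auto
  have "\<exists>L. linear_extension_on V P L \<and> (\<forall>x\<in>V. \<forall>y\<in>V. u x i < l y i \<longrightarrow> (x, y) \<in> L)"
    if "i < ?k" for i
    using linear_extension_respecting_intervals[OF fin po, of "\<lambda>v. l v i" "\<lambda>v. u v i"]
      meet that by metis
  then obtain A where A: "\<And>i. i < ?k \<Longrightarrow> linear_extension_on V P (A i)"
    "\<And>i x y. i < ?k \<Longrightarrow> x \<in> V \<Longrightarrow> y \<in> V \<Longrightarrow> u x i < l y i \<Longrightarrow> (x, y) \<in> A i"
    by metis
  \<comment> \<open>Reflection sends [l, u] to [-u, -l], so x now precedes y when its interval lies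
    to the right.\<close>
  have "\<exists>L. linear_extension_on V P L \<and> (\<forall>x\<in>V. \<forall>y\<in>V. u y i < l x i \<longrightarrow> (x, y) \<in> L)"
    if "i < ?k" for i
    using linear_extension_respecting_intervals[OF fin po, of "\<lambda>v. - u v i" "\<lambda>v. - l v i"]
      meet that by (metis neg_less_iff_less neg_le_iff_le)
  then obtain B where B: "\<And>i. i < ?k \<Longrightarrow> linear_extension_on V P (B i)"
    "\<And>i x y. i < ?k \<Longrightarrow> x \<in> V \<Longrightarrow> y \<in> V \<Longrightarrow> u y i < l x i \<Longrightarrow> (x, y) \<in> B i"
    by metis
  show ?thesis
  proof (cases "?k = 0")
    case True
    \<comment> \<open>The graph is complete, so \<open>P\<close> is a chain and realizes itself.\<close>
    then have "realizer_on V P {P}"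
      using adj po by (intro realizer_onI)
        (auto simp: linear_extension_on_def linear_order_on_def total_on_def)
    \<comment> \<open>A one-element realizer contradicts dimension above 1. Chains with at least two
      elements are thereby excluded: they have dimension 1 but boxicity 0.\<close>
    from poset_dim_le[OF this] assms(3) show ?thesis by simp
  next
    case False
    define R where "R = A ` {..<?k} \<union> B ` {..<?k}"
    have "realizer_on V P R"
    proof (rule realizer_onI)
      fix x y assume xy: "x \<in> V" "y \<in> V" "x \<noteq> y" "(x, y) \<notin> P" "(y, x) \<notin> P"
      then obtain i where i: "i < ?k" "u y i < l x i \<or> u x i < l y i"
        using adj[of x y] by (auto simp: not_le)
      \<comment> \<open>If the interval of y lies to the left, \<open>A i\<close> puts y first; if
        it lies to the right, \<open>B i\<close> does.\<close>
      then have "(y, x) \<in> A i \<or> (y, x) \<in> B i"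
        using A(2) B(2) xy by blast
      with i(1) show "\<exists>L\<in>R. (y, x) \<in> L"
        unfolding R_def by blast
    qed (use A(1) B(1) False in \<open>auto simp: R_def\<close>)
    then have "poset_dim V P \<le> card R"
      by (rule poset_dim_le) (simp add: R_def)
    also have "\<dots> \<le> card (A ` {..<?k}) + card (B ` {..<?k})"
      unfolding R_def by (rule card_Un_le)
    also have "\<dots> \<le> ?k + ?k"
      using card_image_le[of "{..<?k}" A] card_image_le[of "{..<?k}" B] by simp
    finally show ?thesis by simp
  qed
qed

end
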